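(* Let $R\ge 1$, let $r_1,\dots,r_R$ be independent, identically distributed real random variables with finite variance $\sigma_r^2$, let $\hat v_R=\frac1R\sum_{j=1}^R r_j$, and let $\hat A_i=r_i-\hat v_R$ for $i=1,\dots,R$. Then: (i) (Zero-sum) $\sum_{i=1}^R\hat A_i=0$. (ii) (Variance) $\operatorname{Var}(\hat A_i)=\frac{R-1}{R}\sigma_r^2$ for every $i$. (iii) (Negative correlation) $\operatorname{Cov}(\hat A_i,\hat A_j)=-\frac{\sigma_r^2}{R}$ for all $i\ne j$. (iv) ($\epsilon$-effective rollouts) For every $\epsilon>0$, call rollout $i$ $\epsilon$-effective if $|\hat A_i|=|r_i-\hat v_R|>\epsilon$. The expected fraction $\rho_\epsilon$ of $\epsilon$-effective rollouts satisfies $$\rho_\epsilon=\mathbb{P}\left(|\hat A_i|>\epsilon\right)\le\frac{(R-1)\,\sigma_r^2}{R\,\epsilon^2}.$$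
   Context: In GRPO (Group Relative Policy Optimization), $R$ rollouts are sampled independently from a policy $\pi_\theta$ at a common prompt $s_0$; $r_i$ is the terminal reward of rollout $i$, $\sigma_r^2=\operatorname{Var}_{\pi_\theta}(r\mid s_0)$ is the reward variance under the policy, $\hat v_R$ is the group-mean baseline and $\hat A_i$ is the advantage of rollout $i$. The expected fraction of $\epsilon$-effective rollouts is $\rho_\epsilon=\mathbb{E}\left[\frac1R\,\#\{i:|\hat A_i|>\epsilon\}\right]$. *)

theory Defs
  imports "HOL-Probability.Probability"
begin

definition covariance :: "'a measure \<Rightarrow> ('a \<Rightarrow> real) \<Rightarrow> ('a \<Rightarrow> real) \<Rightarrow> real" where
  "covariance M X Y =
     (\<integral>\<omega>. (X \<omega> - (\<integral>\<eta>. X \<eta> \<partial>M)) * (Y \<omega> - (\<integral>\<eta>. Y \<eta> \<partial>M)) \<partial>M)"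

text \<open>A group of \<open>R\<close> rollouts is indexed by \<open>{1..R}\<close>; \<open>r i\<close> is the terminal reward
  of rollout \<open>i\<close>, as a function on the sample space. Values of \<open>r\<close> at other indices
  are irrelevant.\<close>

definition group_mean :: "nat \<Rightarrow> (nat \<Rightarrow> 'a \<Rightarrow> real) \<Rightarrow> 'a \<Rightarrow> real" where
  "group_mean R r \<omega> = 1 / real R * (\<Sum>j = 1..R. r j \<omega>)"

definition advantage :: "nat \<Rightarrow> (nat \<Rightarrow> 'a \<Rightarrow> real) \<Rightarrow> nat \<Rightarrow> 'a \<Rightarrow> real" where
  "advantage R r i \<omega> = r i \<omega> - group_mean R r \<omega>"

definition effective :: "nat \<Rightarrow> (nat \<Rightarrow> 'a \<Rightarrow> real) \<Rightarrow> real \<Rightarrow> nat \<Rightarrow> 'a \<Rightarrow> bool" where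
  "effective R r \<epsilon> i \<omega> \<longleftrightarrow> \<bar>advantage R r i \<omega>\<bar> > \<epsilon>"

definition effective_fraction ::
  "'a measure \<Rightarrow> nat \<Rightarrow> (nat \<Rightarrow> 'a \<Rightarrow> real) \<Rightarrow> real \<Rightarrow> real" where
  "effective_fraction M R r \<epsilon> =
     (\<integral>\<omega>. 1 / real R * real (card {i \<in> {1..R}. effective R r \<epsilon> i \<omega>}) \<partial>M)"

end

theory Submission
  imports Defs
begin

text \<open>After centering the rewards, \<open>Y k = r k - \<mu>\<close>, the advantages are the linear combinations
  of the uncorrelated variables \<open>Y k\<close> with coefficients \<open>\<delta>\<^sub>i\<^sub>k - 1 / R\<close>, so their covariances are
  \<open>\<sigma>\<^sup>2\<close> times the scalar products of the coefficient vectors. A permutation of the rewards leaves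
  their joint distribution unchanged and permutes the advantages; hence all advantages have the same
  law, and Chebyshev's inequality gives the tail bound.\<close>

section \<open>Reindexing of independent families and exchangeability\<close>

lemma (in prob_space) indep_sets_reindex:
  assumes inj: "inj_on f I" and indep: "indep_sets F (f ` I)"
  shows "indep_sets (\<lambda>i. F (f i)) I"
proof (rule indep_setsI)
  show "F (f i) \<subseteq> events" if "i \<in> I" for i
    using indep that by (auto simp: indep_sets_def)
next
  fix A J assume J: "J \<noteq> {}" "J \<subseteq> I" "finite J" and A: "\<forall>j\<in>J. A j \<in> F (f j)"
  have injJ: "inj_on f J"
    using inj J(2) by (rule inj_on_subset)
  \<comment> \<open>Moves the events from \<open>J\<close> to its image under \<open>f\<close>,
    where independence is known. Injectivity of \<open>f\<close> on \<open>J\<close> guarantees that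
    no event is lost or replaced on the way.\<close>
  define B where "B k = A (inv_into J f k)" for k
  have B: "B (f j) = A j" if "j \<in> J" for j
    using that injJ by (simp add: B_def)
  have "prob (\<Inter>k\<in>f ` J. B k) = (\<Prod>k\<in>f ` J. prob (B k))"
    using J A B by (intro indep_setsD[OF indep]) auto
  then show "prob (\<Inter>j\<in>J. A j) = (\<Prod>j\<in>J. prob (A j))"
    using B by (simp add: prod.reindex[OF injJ])
qed

lemma (in prob_space) indep_vars_reindex:
  assumes "inj_on f I" and "indep_vars M' X (f ` I)"
  shows "indep_vars (\<lambda>i. M' (f i)) (\<lambda>i. X (f i)) I"
  using assms indep_sets_reindex[of f I "\<lambda>i. {X i -` A \<inter> space M | A. A \<in> sets (M' i)}"]
  unfolding indep_vars_def2 by blast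

text \<open>Independence makes each joint law the product of its marginals. Since all marginals
  agree, permuting the factors gives the same product measure.\<close>

lemma (in prob_space) iid_exchangeable:
  assumes indep: "indep_vars (\<lambda>_. N) X I"
    and ident: "\<And>i j. i \<in> I \<Longrightarrow> j \<in> I \<Longrightarrow> distr M N (X i) = distr M N (X j)"
    and bij: "bij_betw \<pi> I I"
    and "I \<noteq> {}"
  shows "distr M (PiM I (\<lambda>_. N)) (\<lambda>\<omega>. \<lambda>i\<in>I. X (\<pi> i) \<omega>) = distr M (PiM I (\<lambda>_. N)) (\<lambda>\<omega>. \<lambda>i\<in>I. X i \<omega>)"
proof -
  have img: "\<pi> ` I = I" and inj: "inj_on \<pi> I"
    using bij by (auto simp: bij_betw_def)
  have rv: "random_variable N (X i)" if "i \<in> I" for i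
    using indep that by (auto simp: indep_vars_def)
  have "indep_vars (\<lambda>_. N) (\<lambda>i. X (\<pi> i)) I"
    using indep_vars_reindex[OF inj, of "\<lambda>_. N" X] indep img by simp
  then have "distr M (PiM I (\<lambda>_. N)) (\<lambda>\<omega>. \<lambda>i\<in>I. X (\<pi> i) \<omega>) = PiM I (\<lambda>i. distr M N (X (\<pi> i)))"
    using indep_vars_iff_distr_eq_PiM'[of I "\<lambda>i. X (\<pi> i)" "\<lambda>_. N"] rv img \<open>I \<noteq> {}\<close> by blast
  also have "\<dots> = PiM I (\<lambda>i. distr M N (X i))"
    using ident img by (intro PiM_cong refl) blast
  also have "\<dots> = distr M (PiM I (\<lambda>_. N)) (\<lambda>\<omega>. \<lambda>i\<in>I. X i \<omega>)"
    using indep_vars_iff_distr_eq_PiM'[of I X "\<lambda>_. N"] rv indep \<open>I \<noteq> {}\<close> by auto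
  finally show ?thesis .
qed

section \<open>Second moments of linear combinations\<close>

lemma integral_product_uncorrelated_sums:
  fixes Y :: "'i \<Rightarrow> 'a \<Rightarrow> real"
  assumes int: "\<And>k l. k \<in> I \<Longrightarrow> l \<in> I \<Longrightarrow> integrable M (\<lambda>\<omega>. Y k \<omega> * Y l \<omega>)"
    and uncorr: "\<And>k l. k \<in> I \<Longrightarrow> l \<in> I \<Longrightarrow> (\<integral>\<omega>. Y k \<omega> * Y l \<omega> \<partial>M) = (if k = l then s else 0)"
    and "finite I"
  shows "integrable M (\<lambda>\<omega>. (\<Sum>k\<in>I. a k * Y k \<omega>) * (\<Sum>k\<in>I. b k * Y k \<omega>))"
    and "(\<integral>\<omega>. (\<Sum>k\<in>I. a k * Y k \<omega>) * (\<Sum>k\<in>I. b k * Y k \<omega>) \<partial>M) = s * (\<Sum>k\<in>I. a k * b k)"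
proof -
  have eq: "(\<Sum>k\<in>I. a k * Y k \<omega>) * (\<Sum>k\<in>I. b k * Y k \<omega>)
      = (\<Sum>k\<in>I. \<Sum>l\<in>I. a k * b l * (Y k \<omega> * Y l \<omega>))" for \<omega>
    by (simp add: sum_product mult_ac)
  show "integrable M (\<lambda>\<omega>. (\<Sum>k\<in>I. a k * Y k \<omega>) * (\<Sum>k\<in>I. b k * Y k \<omega>))"
    unfolding eq by (intro Bochner_Integration.integrable_sum integrable_mult_right int)
  have "(\<integral>\<omega>. (\<Sum>k\<in>I. a k * Y k \<omega>) * (\<Sum>k\<in>I. b k * Y k \<omega>) \<partial>M)
      = (\<Sum>k\<in>I. \<Sum>l\<in>I. a k * b l * (\<integral>\<omega>. Y k \<omega> * Y l \<omega> \<partial>M))"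
    unfolding eq by (simp add: Bochner_Integration.integral_sum int)
  \<comment> \<open>The mixed terms vanish, and every diagonal term carries the same second moment
    \<open>s\<close>.\<close>
  also have "\<dots> = (\<Sum>k\<in>I. \<Sum>l\<in>I. if k = l then a k * b l * s else 0)"
    using uncorr by (intro sum.cong) auto
  also have "\<dots> = s * (\<Sum>k\<in>I. a k * b k)"
    unfolding sum_distrib_left using \<open>finite I\<close> by (intro sum.cong refl) simp
  finally show "(\<integral>\<omega>. (\<Sum>k\<in>I. a k * Y k \<omega>) * (\<Sum>k\<in>I. b k * Y k \<omega>) \<partial>M) = s * (\<Sum>k\<in>I. a k * b k)" .
qed

section \<open>Algebra of the advantages\<close>

lemma sum_advantage:
  assumes "R \<ge> 1"
  shows "(\<Sum>i = 1..R. advantage R r i \<omega>) = 0"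
  using assms by (simp add: advantage_def group_mean_def sum_subtractf)

text \<open>The coefficients sum to zero over \<open>k\<close>, so shifting all rewards by a
  constant \<open>c\<close> has no effect. Later \<open>c\<close> is the common mean.\<close>

lemma advantage_eq_sum_centered:
  assumes "i \<in> {1..R}"
  shows "advantage R r i \<omega> = (\<Sum>k = 1..R. ((if k = i then 1 else 0) - 1 / real R) * (r k \<omega> - c))"
proof -
  have "(\<Sum>k = 1..R. ((if k = i then 1 else 0) - 1 / real R) * (r k \<omega> - c))
      = (\<Sum>k = 1..R. if k = i then r k \<omega> - c else 0) - 1 / real R * (\<Sum>k = 1..R. r k \<omega> - c)"
    unfolding sum_distrib_left sum_subtractf[symmetric]
    by (intro sum.cong) (auto simp: algebra_simps)
  also have "\<dots> = advantage R r i \<omega>"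
    using assms by (simp add: advantage_def group_mean_def sum_subtractf field_simps)
  finally show ?thesis ..
qed

text \<open>The coefficient vector of \<open>i\<close> is the \<open>i\<close>-th unit vector
  projected orthogonally to the all-ones vector. The projection is symmetric and idempotent, so the
  scalar products are its own matrix entries.\<close>

lemma sum_product_advantage_coefficients:
  assumes "i \<in> {1..R}" and "j \<in> {1..R}"
  shows "(\<Sum>k = 1..R. ((if k = i then 1 else 0) - 1 / real R) * ((if k = j then 1 else 0) - 1 / real R))
    = (if i = j then 1 else 0) - 1 / real R"
proof -
  \<comment> \<open>In the expanded product, the two cross terms contribute
    \<open>- 1 / real R\<close> each and the \<open>R\<close> constant terms together
    \<open>1 / real R\<close>, which cancels one of them.\<close>
  have "(\<Sum>k = 1..R. ((if k = i then 1 else 0) - 1 / real R) * ((if k = j then 1 else 0) - 1 / real R))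
      = (\<Sum>k = 1..R. (if k = i then (if i = j then 1 else 0) - 1 / real R else 0)
          - (if k = j then 1 / real R else 0) + 1 / real R * (1 / real R))"
    by (intro sum.cong) (auto simp: algebra_simps)
  also have "\<dots> = (if i = j then 1 else 0) - 1 / real R"
    using assms unfolding sum.distrib sum_subtractf by simp
  finally show ?thesis .
qed

section \<open>The reward model; mean and covariances of the advantages\<close>

locale iid_rewards = prob_space M for M :: "'a measure" +
  fixes R :: nat and r :: "nat \<Rightarrow> 'a \<Rightarrow> real" and \<sigma> :: real
  assumes indep: "indep_vars (\<lambda>_. borel) r {1..R}"
    and ident: "\<And>i j. i \<in> {1..R} \<Longrightarrow> j \<in> {1..R} \<Longrightarrow> distr M borel (r i) = distr M borel (r j)"
    and mean_finite: "\<And>i. i \<in> {1..R} \<Longrightarrow> integrable M (r i)"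
    and var_finite: "\<And>i. i \<in> {1..R} \<Longrightarrow> integrable M (\<lambda>\<omega>. (r i \<omega> - expectation (r i))\<^sup>2)"
    and var: "\<And>i. i \<in> {1..R} \<Longrightarrow> variance (r i) = \<sigma>\<^sup>2"
begin

lemma reward_measurable [measurable]: "i \<in> {1..R} \<Longrightarrow> r i \<in> borel_measurable M"
  using mean_finite by blast

lemma advantage_measurable [measurable]:
  assumes "i \<in> {1..R}"
  shows "advantage R r i \<in> borel_measurable M"
  using assms unfolding advantage_def [abs_def] group_mean_def
  by (intro borel_measurable_diff borel_measurable_times borel_measurable_const borel_measurable_sum
      reward_measurable)

text \<open>An expectation is the integral of the identity against the law, and the laws
  agree.\<close>

lemma expectation_reward_eq:
  assumes "i \<in> {1..R}" and "j \<in> {1..R}"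
  shows "expectation (r i) = expectation (r j)"
proof -
  have "expectation (r k) = (\<integral>x. x \<partial>distr M borel (r k))" if "k \<in> {1..R}" for k
    using reward_measurable[OF that] by (simp add: integral_distr)
  then show ?thesis
    using ident[OF assms] assms by metis
qed

text \<open>The group mean has the common mean of the rewards as its expectation.\<close>

lemma expectation_advantage:
  assumes "i \<in> {1..R}"
  shows "expectation (advantage R r i) = 0"
proof -
  have "expectation (advantage R r i) = expectation (r i) - 1 / real R * (\<Sum>j = 1..R. expectation (r j))"
    unfolding advantage_def group_mean_def using mean_finite assms
    by (subst Bochner_Integration.integral_diff)
      (auto simp: Bochner_Integration.integral_sum
        intro!: integrable_mult_right Bochner_Integration.integrable_sum)
  also have "(\<Sum>j = 1..R. expectation (r j)) = (\<Sum>j = 1..R. expectation (r i))"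
    using assms by (intro sum.cong refl expectation_reward_eq)
  finally show ?thesis
    using assms by simp
qed

text \<open>The diagonal case is the variance. Off the diagonal, independence factors the
  expectation into means of centered variables, which are zero.\<close>

lemma centered_rewards_uncorrelated:
  fixes k l :: nat
  defines "Y \<equiv> \<lambda>i \<omega>. r i \<omega> - expectation (r i)"
  assumes k: "k \<in> {1..R}" and l: "l \<in> {1..R}"
  shows "integrable M (\<lambda>\<omega>. Y k \<omega> * Y l \<omega>)"
    and "expectation (\<lambda>\<omega>. Y k \<omega> * Y l \<omega>) = (if k = l then \<sigma>\<^sup>2 else 0)"
proof -
  have "integrable M (\<lambda>\<omega>. Y k \<omega> * Y l \<omega>) \<and> expectation (\<lambda>\<omega>. Y k \<omega> * Y l \<omega>) = (if k = l then \<sigma>\<^sup>2 else 0)"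
  proof (cases "k = l")
    case True
    then show ?thesis
      using var_finite[OF k] var[OF k] by (simp add: Y_def power2_eq_square)
  next
    case False
    have int: "integrable M (Y i)" if "i \<in> {1..R}" for i
      using mean_finite[OF that] by (simp add: Y_def [abs_def])
    have zero: "expectation (Y i) = 0" if "i \<in> {1..R}" for i
      using mean_finite[OF that] by (simp add: Y_def [abs_def] prob_space)
    have "indep_vars (\<lambda>_. borel) Y {1..R}"
      unfolding Y_def by (rule indep_vars_compose2[OF indep]) simp
    \<comment> \<open>The pair is treated as a family indexed by \<open>{k, l}\<close>; since
      \<open>k \<noteq> l\<close>, the product over this set is \<open>Y k * Y l\<close>.
      Independence yields its integrability from that of the two factors.\<close>
    then have "indep_vars (\<lambda>_. borel) Y {k, l}"
      by (rule indep_vars_subset) (use k l in auto)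
    then have prod: "integrable M (\<lambda>\<omega>. \<Prod>i\<in>{k, l}. Y i \<omega>)"
      "expectation (\<lambda>\<omega>. \<Prod>i\<in>{k, l}. Y i \<omega>) = (\<Prod>i\<in>{k, l}. expectation (Y i))"
      using int k l by (intro indep_vars_integrable indep_vars_lebesgue_integral; auto)+
    then show ?thesis
      using False zero[OF k] by simp
  qed
  then show "integrable M (\<lambda>\<omega>. Y k \<omega> * Y l \<omega>)"
    and "expectation (\<lambda>\<omega>. Y k \<omega> * Y l \<omega>) = (if k = l then \<sigma>\<^sup>2 else 0)"
    by auto
qed

lemma advantage_product:
  assumes i: "i \<in> {1..R}" and j: "j \<in> {1..R}"
  shows "integrable M (\<lambda>\<omega>. advantage R r i \<omega> * advantage R r j \<omega>)"
    and "expectation (\<lambda>\<omega>. advantage R r i \<omega> * advantage R r j \<omega>)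
      = \<sigma>\<^sup>2 * ((if i = j then 1 else 0) - 1 / real R)"
proof -
  \<comment> \<open>The representation of the advantages uses a single constant, while
    uncorrelatedness is stated with the mean of each reward; equality of the means reconciles the
    two.\<close>
  define c where "c = expectation (r i)"
  have c: "expectation (r k) = c" if "k \<in> {1..R}" for k
    unfolding c_def by (rule expectation_reward_eq[OF that i])
  have uncorr: "integrable M (\<lambda>\<omega>. (r k \<omega> - c) * (r l \<omega> - c))"
    "expectation (\<lambda>\<omega>. (r k \<omega> - c) * (r l \<omega> - c)) = (if k = l then \<sigma>\<^sup>2 else 0)"
    if "k \<in> {1..R}" "l \<in> {1..R}" for k l
    using centered_rewards_uncorrelated[OF that] unfolding c[OF that(1)] c[OF that(2)] .
  note sums = integral_product_uncorrelated_sums[where Y = "\<lambda>k \<omega>. r k \<omega> - c" and M = M,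
      OF uncorr finite_atLeastAtMost]
  show "integrable M (\<lambda>\<omega>. advantage R r i \<omega> * advantage R r j \<omega>)"
    unfolding advantage_eq_sum_centered[OF i, where c = c] advantage_eq_sum_centered[OF j, where c = c]
    by (rule sums(1))
  show "expectation (\<lambda>\<omega>. advantage R r i \<omega> * advantage R r j \<omega>)
      = \<sigma>\<^sup>2 * ((if i = j then 1 else 0) - 1 / real R)"
    unfolding advantage_eq_sum_centered[OF i, where c = c] advantage_eq_sum_centered[OF j, where c = c]
      sum_product_advantage_coefficients[OF i j, symmetric]
    by (rule sums(2))
qed

text \<open>The advantages have mean zero, so the covariance is the plain product moment. The case
  \<open>i = j\<close> yields the variance, the other case the negative correlation.\<close>

lemma covariance_advantage:
  assumes "i \<in> {1..R}" and "j \<in> {1..R}"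
  shows "covariance M (advantage R r i) (advantage R r j) = \<sigma>\<^sup>2 * ((if i = j then 1 else 0) - 1 / real R)"
  using advantage_product(2)[OF assms] assms by (simp add: covariance_def expectation_advantage)

lemma variance_advantage:
  assumes "i \<in> {1..R}"
  shows "variance (advantage R r i) = (real R - 1) / real R * \<sigma>\<^sup>2"
proof -
  have "variance (advantage R r i) = \<sigma>\<^sup>2 * (1 - 1 / real R)"
    using covariance_advantage[OF assms assms] by (simp add: covariance_def power2_eq_square)
  \<comment> \<open>Membership of \<open>i\<close> in \<open>{1..R}\<close> makes \<open>R\<close>
    nonzero, so the denominator can be cleared.\<close>
  then show ?thesis
    using assms by (simp add: field_simps)
qed

section \<open>The common law of the advantages and the tail bound\<close>

lemma distr_advantage_eq:
  assumes i: "i \<in> {1..R}" and j: "j \<in> {1..R}"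
  shows "distr M borel (advantage R r i) = distr M borel (advantage R r j)"
proof -
  \<comment> \<open>Swapping \<open>i\<close> and \<open>j\<close> preserves the group mean and puts
    reward \<open>j\<close> in position \<open>i\<close>. So \<open>F\<close>, the
    \<open>i\<close>-th advantage as a function of the reward vector, returns advantage
    \<open>j\<close> on the permuted vector.\<close>
  define \<pi> where "\<pi> = Transposition.transpose i j"
  define F where "F x = x i - 1 / real R * (\<Sum>k = 1..R. x k)" for x :: "nat \<Rightarrow> real"
  let ?P = "PiM {1..R} (\<lambda>_. borel :: real measure)"
  have bij: "bij_betw \<pi> {1..R} {1..R}"
    unfolding \<pi>_def using i j by simp
  have F: "F \<in> borel_measurable ?P"
    unfolding F_def [abs_def] using i by measurable
  have rv: "(\<lambda>\<omega>. \<lambda>k\<in>{1..R}. r (\<tau> k) \<omega>) \<in> measurable M ?P" if "\<tau> ` {1..R} \<subseteq> {1..R}" for \<tau>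
    using that by (intro measurable_restrict reward_measurable) blast
  have Fid: "F (\<lambda>k\<in>{1..R}. r k \<omega>) = advantage R r i \<omega>" for \<omega>
    using i by (simp add: F_def advantage_def group_mean_def)
  have "(\<Sum>k = 1..R. r (\<pi> k) \<omega>) = (\<Sum>k = 1..R. r k \<omega>)" for \<omega>
    by (rule sum.reindex_bij_betw[OF bij])
  then have F\<pi>: "F (\<lambda>k\<in>{1..R}. r (\<pi> k) \<omega>) = advantage R r j \<omega>" for \<omega>
    using i by (simp add: F_def advantage_def group_mean_def \<pi>_def)
  \<comment> \<open>Both advantages are images under the same \<open>F\<close> of reward vectors
    whose laws coincide by exchangeability.\<close>
  have "distr M borel (advantage R r j) = distr (distr M ?P (\<lambda>\<omega>. \<lambda>k\<in>{1..R}. r (\<pi> k) \<omega>)) borel F"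
    using bij by (subst distr_distr[OF F rv]) (auto simp: comp_def F\<pi> bij_betw_def simp del: One_nat_def)
  also have "\<dots> = distr (distr M ?P (\<lambda>\<omega>. \<lambda>k\<in>{1..R}. r k \<omega>)) borel F"
    using i by (subst iid_exchangeable[OF indep ident bij]) auto
  also have "\<dots> = distr M borel (advantage R r i)"
    using rv[of "\<lambda>k. k"] by (subst distr_distr[OF F]) (auto simp: comp_def Fid simp del: One_nat_def)
  finally show ?thesis ..
qed

lemma prob_advantage_gt_eq:
  assumes i: "i \<in> {1..R}" and j: "j \<in> {1..R}"
  shows "prob {\<omega> \<in> space M. \<bar>advantage R r i \<omega>\<bar> > \<epsilon>} = prob {\<omega> \<in> space M. \<bar>advantage R r j \<omega>\<bar> > \<epsilon>}"
proof -
  have "prob {\<omega> \<in> space M. \<bar>advantage R r k \<omega>\<bar> > \<epsilon>} = measure (distr M borel (advantage R r k)) {x. \<bar>x\<bar> > \<epsilon>}"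
    if "k \<in> {1..R}" for k
    using advantage_measurable[OF that]
    by (subst measure_distr) (auto intro!: arg_cong[where f = prob])
  then show ?thesis
    using distr_advantage_eq[OF i j] i j by simp
qed

text \<open>By linearity, the expected fraction is the average of the \<open>R\<close> individual
  tail probabilities, which are all equal.\<close>

lemma effective_fraction_eq_prob:
  assumes i: "i \<in> {1..R}"
  shows "effective_fraction M R r \<epsilon> = prob {\<omega> \<in> space M. \<bar>advantage R r i \<omega>\<bar> > \<epsilon>}"
proof -
  define E where "E k = {\<omega> \<in> space M. \<bar>advantage R r k \<omega>\<bar> > \<epsilon>}" for k
  have E: "E k \<in> events" if "k \<in> {1..R}" for k
    unfolding E_def using advantage_measurable[OF that] by measurable
  have "effective_fraction M R r \<epsilon> = expectation (\<lambda>\<omega>. 1 / real R * (\<Sum>k = 1..R. indicator (E k) \<omega>))"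
    unfolding effective_fraction_def
  proof (intro Bochner_Integration.integral_cong refl)
    fix \<omega> assume "\<omega> \<in> space M"
    \<comment> \<open>The intersection form is the one produced when the sum of indicators is split
      by cases.\<close>
    then have "{k \<in> {1..R}. effective R r \<epsilon> k \<omega>} = {1..R} \<inter> {k. \<omega> \<in> E k}"
      by (auto simp: effective_def E_def)
    then show "1 / real R * real (card {k \<in> {1..R}. effective R r \<epsilon> k \<omega>})
        = 1 / real R * (\<Sum>k = 1..R. indicator (E k) \<omega>)"
      by (simp add: indicator_def sum.If_cases)
  qed
  also have "\<dots> = 1 / real R * (\<Sum>k = 1..R. prob (E k))"
    using E by (simp add: Bochner_Integration.integral_sum emeasure_eq_measure)
  also have "(\<Sum>k = 1..R. prob (E k)) = (\<Sum>k = 1..R. prob (E i))"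
    unfolding E_def by (intro sum.cong refl prob_advantage_gt_eq i)
  finally show ?thesis
    using i by (simp add: E_def)
qed

lemma prob_advantage_gt_le:
  assumes i: "i \<in> {1..R}" and "\<epsilon> > 0"
  shows "prob {\<omega> \<in> space M. \<bar>advantage R r i \<omega>\<bar> > \<epsilon>} \<le> (real R - 1) * \<sigma>\<^sup>2 / (real R * \<epsilon>\<^sup>2)"
proof -
  have [measurable]: "advantage R r i \<in> borel_measurable M"
    by (rule advantage_measurable[OF i])
  \<comment> \<open>Chebyshev bounds the event with the weak inequality, which contains the strict
    one. Its square-integrability condition is the diagonal case of
    \<open>advantage_product(1)\<close>.\<close>
  have "prob {\<omega> \<in> space M. \<bar>advantage R r i \<omega>\<bar> > \<epsilon>} \<le> prob {\<omega> \<in> space M. \<bar>advantage R r i \<omega>\<bar> \<ge> \<epsilon>}"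
    by (intro finite_measure_mono) auto
  also have "\<dots> \<le> variance (advantage R r i) / \<epsilon>\<^sup>2"
    using Chebyshev_inequality[of "advantage R r i" \<epsilon>] advantage_product(1)[OF i i] \<open>\<epsilon> > 0\<close>
    by (simp add: expectation_advantage[OF i] power2_eq_square)
  also have "\<dots> = (real R - 1) * \<sigma>\<^sup>2 / (real R * \<epsilon>\<^sup>2)"
    by (simp add: variance_advantage[OF i])
  finally show ?thesis .
qed

end

section \<open>Assembly of the four claims\<close>

theorem theorem4p1:
  fixes M :: "'a measure" and R :: nat and r :: "nat \<Rightarrow> 'a \<Rightarrow> real" and \<sigma> :: real
  assumes "prob_space M"
    and "R \<ge> 1"
    and indep: "prob_space.indep_vars M (\<lambda>_. borel) r {1..R}"
    and ident: "\<And>i j. i \<in> {1..R} \<Longrightarrow> j \<in> {1..R} \<Longrightarrow> distr M borel (r i) = distr M borel (r j)"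
    and mean_finite: "\<And>i. i \<in> {1..R} \<Longrightarrow> integrable M (r i)"
    and var_finite: "\<And>i. i \<in> {1..R} \<Longrightarrow>
          integrable M (\<lambda>\<omega>. (r i \<omega> - prob_space.expectation M (r i))\<^sup>2)"
    and var: "\<And>i. i \<in> {1..R} \<Longrightarrow> prob_space.variance M (r i) = \<sigma>\<^sup>2"
  shows "(\<forall>\<omega>\<in>space M. (\<Sum>i = 1..R. advantage R r i \<omega>) = 0)
    \<and> (\<forall>i\<in>{1..R}. prob_space.variance M (advantage R r i) = (real R - 1) / real R * \<sigma>\<^sup>2)
    \<and> (\<forall>i\<in>{1..R}. \<forall>j\<in>{1..R}. i \<noteq> j \<longrightarrow>
         covariance M (advantage R r i) (advantage R r j) = - (\<sigma>\<^sup>2 / real R))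
    \<and> (\<forall>\<epsilon>>0. \<forall>i\<in>{1..R}.
         effective_fraction M R r \<epsilon> = prob_space.prob M {\<omega> \<in> space M. \<bar>advantage R r i \<omega>\<bar> > \<epsilon>}
         \<and> prob_space.prob M {\<omega> \<in> space M. \<bar>advantage R r i \<omega>\<bar> > \<epsilon>}
             \<le> (real R - 1) * \<sigma>\<^sup>2 / (real R * \<epsilon>\<^sup>2))"
proof -
  interpret iid_rewards M R r \<sigma>
    by (rule iid_rewards.intro[OF \<open>prob_space M\<close> iid_rewards_axioms.intro]) (fact assms)+
  show ?thesis
  proof (intro conjI ballI allI impI)
    show "(\<Sum>i = 1..R. advantage R r i \<omega>) = 0" for \<omega>
      using \<open>R \<ge> 1\<close> by (rule sum_advantage)
    show "variance (advantage R r i) = (real R - 1) / real R * \<sigma>\<^sup>2" if "i \<in> {1..R}" for i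
      using that by (rule variance_advantage)
    show "covariance M (advantage R r i) (advantage R r j) = - (\<sigma>\<^sup>2 / real R)"
      if "i \<in> {1..R}" "j \<in> {1..R}" "i \<noteq> j" for i j
      \<comment> \<open>For distinct indices the Kronecker term drops out and only
        \<open>- 1 / real R\<close> remains.\<close>
      using covariance_advantage[OF that(1,2)] that(3) by simp
    show "effective_fraction M R r \<epsilon> = prob {\<omega> \<in> space M. \<bar>advantage R r i \<omega>\<bar> > \<epsilon>}"
      if "i \<in> {1..R}" for \<epsilon> i
      using that by (rule effective_fraction_eq_prob)
    show "prob {\<omega> \<in> space M. \<bar>advantage R r i \<omega>\<bar> > \<epsilon>} \<le> (real R - 1) * \<sigma>\<^sup>2 / (real R * \<epsilon>\<^sup>2)"
      if "\<epsilon> > 0" "i \<in> {1..R}" for \<epsilon> i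
      using that(2,1) by (rule prob_advantage_gt_le)
  qed
qed

end
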